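(* Let $\varphi,\psi$ be propositional formulas in the signature $\{\wedge,\vee,\to,0,1\}$. Then $\varphi\vdash\psi$ is valid in all Heyting algebras and in all orthomodular algebras if and only if $\varphi\vdash\psi$ is valid in every fundamental algebra satisfying (for all elements $a,b,c,d$, with $\lnot x:=x\to 0$) the following axioms: - (nS) $\lnot(a\to b)=\lnot(\lnot a\vee(a\wedge b))$; - (MP) $a\wedge(a\to b)=a\wedge b$; - (M) $(a\wedge b)\to b=1$; - (W4) $a\to(b\wedge c)\leq a\to b$; - (iCl$_1$) $a\wedge((a\wedge b)\to c)\leq b\vee(b\to c)$; - (iCl$_2$) $((b\wedge c)\vee(b\wedge d))\to a\leq(b\wedge(c\vee d))\vee\big((b\wedge(c\vee d))\to a\big)$; - (Nu) $\lnot\lnot a\wedge\lnot\lnot b\leq\lnot\lnot(a\wedge b)$; - (Vi) $a\wedge(b\vee c)\wedge\lnot\lnot d\leq(a\wedge b)\vee(a\wedge c)\vee d$. In other words, the joint validities of intuitionistic logic and orthomodular logic with implication are axiomatized over fundamental logic with implication by these principles.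
   Context: A fundamental algebra is a structure $(L,\wedge,\vee,0,1,\to)$ such that $(L,\wedge,\vee,0,1)$ is a bounded lattice, $\to$ is a binary operation, and, with $\lnot a:=a\to 0$, for all $a,b\in L$: (i) $a\leq b$ implies $\lnot b\leq\lnot a$; (ii) $a\wedge\lnot a=0$; (iii) $a\leq\lnot\lnot a$. An orthomodular algebra is a fundamental algebra such that for all $a,b$: $\lnot\lnot a=a$, $a\wedge(a\to b)\leq b$, and $a\to b=\lnot a\vee(a\wedge b)$ (the Sasaki implication). Orthomodular logic is the logic of orthomodular algebras. A Heyting algebra is a fundamental algebra satisfying, for all $a,b,c$: $c\wedge a\leq b$ iff $c\leq a\to b$. Intuitionistic logic is the logic of Heyting algebras. A valuation into a fundamental algebra $L$ assigns elements of $L$ to propositional variables and extends to all formulas by interpreting the connectives as the operations of $L$. $\varphi\vdash\psi$ is valid in $L$ if $v(\varphi)\leq v(\psi)$ for every valuation $v$ into $L$. *)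

theory Defs
  imports Main "HOL-Algebra.Lattice"
begin

text \<open>
  Algebras live on an explicit carrier set inside a type, so that one formula can quantify over all
  algebras of a class. Validity in a class is stated relative to an infinite type supplying the
  carriers; every finite or countable algebra has a copy there, and refuting a sequent never needs
  more, since the subalgebra generated by the values of the finitely many variables is countable.
  The lattice part is the order-theoretic one of HOL-Algebra: \<open>\<sqinter>\<close>, \<open>\<squnion>\<close>, \<open>\<bottom>\<close>,
  \<open>\<top>\<close> are derived from \<open>\<sqsubseteq>\<close>, and in \<open>bounded_lattice\<close> the record's equivalence is equality.
\<close>

record 'a imp_algebra = "'a gorder" +
  imp :: "['a, 'a] \<Rightarrow> 'a" (infixr \<open>\<leadsto>\<index>\<close> 60)

definition neg :: "[('a, 'b) imp_algebra_scheme, 'a] \<Rightarrow> 'a" (\<open>\<sim>\<index>_\<close> [80] 80)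
  where "\<sim>\<^bsub>L\<^esub> a = (a \<leadsto>\<^bsub>L\<^esub> \<bottom>\<^bsub>L\<^esub>)"

locale fundamental_algebra = bounded_lattice L
  for L :: "('a, 'b) imp_algebra_scheme" (structure) +
  assumes imp_closed: "\<lbrakk>a \<in> carrier L; b \<in> carrier L\<rbrakk> \<Longrightarrow> a \<leadsto> b \<in> carrier L"
    and neg_antitone: "\<lbrakk>a \<in> carrier L; b \<in> carrier L; a \<sqsubseteq> b\<rbrakk> \<Longrightarrow> \<sim>b \<sqsubseteq> \<sim>a"
    and meet_neg: "a \<in> carrier L \<Longrightarrow> a \<sqinter> \<sim>a = \<bottom>"
    and le_neg_neg: "a \<in> carrier L \<Longrightarrow> a \<sqsubseteq> \<sim>\<sim>a"

locale orthomodular_algebra = fundamental_algebra +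
  assumes neg_neg: "a \<in> carrier L \<Longrightarrow> \<sim>\<sim>a = a"
    and modus_ponens: "\<lbrakk>a \<in> carrier L; b \<in> carrier L\<rbrakk> \<Longrightarrow> a \<sqinter> (a \<leadsto> b) \<sqsubseteq> b"
    and sasaki: "\<lbrakk>a \<in> carrier L; b \<in> carrier L\<rbrakk> \<Longrightarrow> (a \<leadsto> b) = \<sim>a \<squnion> (a \<sqinter> b)"

locale heyting_algebra = fundamental_algebra +
  assumes residuation:
    "\<lbrakk>a \<in> carrier L; b \<in> carrier L; c \<in> carrier L\<rbrakk> \<Longrightarrow> c \<sqinter> a \<sqsubseteq> b \<longleftrightarrow> c \<sqsubseteq> a \<leadsto> b"

locale joint_algebra = fundamental_algebra +
  assumes nS: "\<lbrakk>a \<in> carrier L; b \<in> carrier L\<rbrakk> \<Longrightarrow> \<sim>(a \<leadsto> b) = \<sim>(\<sim>a \<squnion> (a \<sqinter> b))"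
    and MP: "\<lbrakk>a \<in> carrier L; b \<in> carrier L\<rbrakk> \<Longrightarrow> a \<sqinter> (a \<leadsto> b) = a \<sqinter> b"
    and M: "\<lbrakk>a \<in> carrier L; b \<in> carrier L\<rbrakk> \<Longrightarrow> ((a \<sqinter> b) \<leadsto> b) = \<top>"
    and W4: "\<lbrakk>a \<in> carrier L; b \<in> carrier L; c \<in> carrier L\<rbrakk>
      \<Longrightarrow> (a \<leadsto> (b \<sqinter> c)) \<sqsubseteq> (a \<leadsto> b)"
    and iCl1: "\<lbrakk>a \<in> carrier L; b \<in> carrier L; c \<in> carrier L\<rbrakk>
      \<Longrightarrow> a \<sqinter> ((a \<sqinter> b) \<leadsto> c) \<sqsubseteq> b \<squnion> (b \<leadsto> c)"
    and iCl2: "\<lbrakk>a \<in> carrier L; b \<in> carrier L; c \<in> carrier L; d \<in> carrier L\<rbrakk>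
      \<Longrightarrow> (((b \<sqinter> c) \<squnion> (b \<sqinter> d)) \<leadsto> a) \<sqsubseteq> (b \<sqinter> (c \<squnion> d)) \<squnion> ((b \<sqinter> (c \<squnion> d)) \<leadsto> a)"
    and Nu: "\<lbrakk>a \<in> carrier L; b \<in> carrier L\<rbrakk> \<Longrightarrow> \<sim>\<sim>a \<sqinter> \<sim>\<sim>b \<sqsubseteq> \<sim>\<sim>(a \<sqinter> b)"
    and Vi: "\<lbrakk>a \<in> carrier L; b \<in> carrier L; c \<in> carrier L; d \<in> carrier L\<rbrakk>
      \<Longrightarrow> a \<sqinter> (b \<squnion> c) \<sqinter> \<sim>\<sim>d \<sqsubseteq> (a \<sqinter> b) \<squnion> (a \<sqinter> c) \<squnion> d"

datatype 'v form =
  Var 'v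
  | Zero
  | One
  | And "'v form" "'v form"
  | Or "'v form" "'v form"
  | Imp "'v form" "'v form"

primrec eval :: "('a, 'b) imp_algebra_scheme \<Rightarrow> ('v \<Rightarrow> 'a) \<Rightarrow> 'v form \<Rightarrow> 'a" where
  "eval L v (Var p) = v p"
| "eval L v Zero = \<bottom>\<^bsub>L\<^esub>"
| "eval L v One = \<top>\<^bsub>L\<^esub>"
| "eval L v (And \<phi> \<psi>) = eval L v \<phi> \<sqinter>\<^bsub>L\<^esub> eval L v \<psi>"
| "eval L v (Or \<phi> \<psi>) = eval L v \<phi> \<squnion>\<^bsub>L\<^esub> eval L v \<psi>"
| "eval L v (Imp \<phi> \<psi>) = (eval L v \<phi> \<leadsto>\<^bsub>L\<^esub> eval L v \<psi>)"

definition valid_in :: "('a, 'b) imp_algebra_scheme \<Rightarrow> 'v form \<Rightarrow> 'v form \<Rightarrow> bool" where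
  "valid_in L \<phi> \<psi> \<longleftrightarrow> (\<forall>v. (\<forall>p. v p \<in> carrier L) \<longrightarrow> eval L v \<phi> \<sqsubseteq>\<^bsub>L\<^esub> eval L v \<psi>)"

end

theory Submission
  imports Defs "HOL-Library.Countable_Set"
begin

text \<open>
  In a joint algebra \<open>L\<close>, (Nu) and (nS) make double negation a homomorphism onto the regular
  elements, which form an orthomodular algebra; so a valid sequent at least gives
  \<open>v(\<phi>) \<le> \<not>\<not>v(\<psi>)\<close>. On the other hand, (iCl1) and (iCl2) say that every prime filter behaves
  as in a Heyting algebra: the quotient by it is distributive, and implication is decided by the
  prime filters above it. Hence sending \<open>a\<close> to the set of prime filters containing \<open>a\<close> is a
  homomorphism into the Heyting algebra of up-sets of prime filters. Finally (Vi) provides just the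
  distributivity needed to separate \<open>a\<close> from \<open>b\<close> by a prime filter when \<open>a \<le> \<not>\<not>b\<close> but not
  \<open>a \<le> b\<close>.
\<close>

subsection \<open>Bounded lattices\<close>

text \<open>\<open>meet\<close>, \<open>join\<close>, \<open>bottom\<close> and \<open>top\<close>
  are chosen from the order, so concrete candidates have to be identified with them by uniqueness of
  bounds. This serves the three concrete lattices below: the copied subalgebra, the regular elements
  and the up-sets.\<close>

lemma bounded_lattice_presentation:
  fixes L (structure)
  assumes eq: "(.=) = (=)"
    and refl: "\<And>x. x \<in> carrier L \<Longrightarrow> x \<sqsubseteq> x"
    and antisym: "\<And>x y. \<lbrakk>x \<in> carrier L; y \<in> carrier L; x \<sqsubseteq> y; y \<sqsubseteq> x\<rbrakk> \<Longrightarrow> x = y"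
    and trans: "\<And>x y z. \<lbrakk>x \<in> carrier L; y \<in> carrier L; z \<in> carrier L; x \<sqsubseteq> y; y \<sqsubseteq> z\<rbrakk> \<Longrightarrow> x \<sqsubseteq> z"
    and zero: "z \<in> carrier L" "\<And>x. x \<in> carrier L \<Longrightarrow> z \<sqsubseteq> x"
    and one: "t \<in> carrier L" "\<And>x. x \<in> carrier L \<Longrightarrow> x \<sqsubseteq> t"
    and mt: "\<And>x y. \<lbrakk>x \<in> carrier L; y \<in> carrier L\<rbrakk> \<Longrightarrow> m x y \<in> carrier L"
      "\<And>x y w. \<lbrakk>x \<in> carrier L; y \<in> carrier L; w \<in> carrier L\<rbrakk> \<Longrightarrow> w \<sqsubseteq> m x y \<longleftrightarrow> w \<sqsubseteq> x \<and> w \<sqsubseteq> y"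
    and jn: "\<And>x y. \<lbrakk>x \<in> carrier L; y \<in> carrier L\<rbrakk> \<Longrightarrow> j x y \<in> carrier L"
      "\<And>x y w. \<lbrakk>x \<in> carrier L; y \<in> carrier L; w \<in> carrier L\<rbrakk> \<Longrightarrow> j x y \<sqsubseteq> w \<longleftrightarrow> x \<sqsubseteq> w \<and> y \<sqsubseteq> w"
  shows "bounded_lattice L"
    and "\<bottom> = z" and "\<top> = t"
    and "\<And>x y. \<lbrakk>x \<in> carrier L; y \<in> carrier L\<rbrakk> \<Longrightarrow> x \<sqinter> y = m x y"
    and "\<And>x y. \<lbrakk>x \<in> carrier L; y \<in> carrier L\<rbrakk> \<Longrightarrow> x \<squnion> y = j x y"
proof -
  interpret partial_order L
    by unfold_locales (use eq refl antisym in \<open>auto intro: trans\<close>)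
  have inf: "greatest L (m x y) (Lower L {x, y})" if "x \<in> carrier L" "y \<in> carrier L" for x y
    using that mt(1) mt(2)[OF that mt(1)[OF that]] mt(2)[OF that] refl
    by (auto simp: greatest_def Lower_def)
  have sup: "least L (j x y) (Upper L {x, y})" if "x \<in> carrier L" "y \<in> carrier L" for x y
    using that jn(1) jn(2)[OF that jn(1)[OF that]] jn(2)[OF that] refl
    by (auto simp: least_def Upper_def)
  interpret bounded_lattice L
  proof unfold_locales
    show "\<exists>x. least L x (carrier L)" using zero by (auto simp: least_def)
    show "\<exists>x. greatest L x (carrier L)" using one by (auto simp: greatest_def)
  qed (use inf sup in blast)+
  show "bounded_lattice L" ..
  show "\<bottom> = z" using zero bottom_eq by simp
  show "\<top> = t" using one top_eq by simp
  show "x \<sqinter> y = m x y" if "x \<in> carrier L" "y \<in> carrier L" for x y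
    using greatest_unique[OF inf_of_two_greatest inf] that by (simp add: meet_def)
  show "x \<squnion> y = j x y" if "x \<in> carrier L" "y \<in> carrier L" for x y
    using least_unique[OF sup_of_two_least sup] that by (simp add: join_def)
qed

context bounded_lattice
begin

text \<open>As introduction rules these make classical reasoning about \<open>\<sqsubseteq>\<close> loop.\<close>
declare le_cong_l [rule del] le_cong_r [rule del] weak_refl [rule del]

lemma le_meet_iff:
  "\<lbrakk>x \<in> carrier L; y \<in> carrier L; w \<in> carrier L\<rbrakk> \<Longrightarrow> w \<sqsubseteq> x \<sqinter> y \<longleftrightarrow> w \<sqsubseteq> x \<and> w \<sqsubseteq> y"
  by (meson le_trans meet_closed meet_le meet_left meet_right)

lemma join_le_iff:
  "\<lbrakk>x \<in> carrier L; y \<in> carrier L; w \<in> carrier L\<rbrakk> \<Longrightarrow> x \<squnion> y \<sqsubseteq> w \<longleftrightarrow> x \<sqsubseteq> w \<and> y \<sqsubseteq> w"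
  by (meson le_trans join_closed join_le join_left join_right)

lemma le_bottom_iff: "x \<in> carrier L \<Longrightarrow> x \<sqsubseteq> \<bottom> \<longleftrightarrow> x = \<bottom>"
  using bottom_lower le_antisym by auto

lemma top_le_iff: "x \<in> carrier L \<Longrightarrow> \<top> \<sqsubseteq> x \<longleftrightarrow> x = \<top>"
  using top_higher le_antisym by auto

lemma meet_le_left:
  "\<lbrakk>x \<sqsubseteq> z; x \<in> carrier L; y \<in> carrier L; z \<in> carrier L\<rbrakk> \<Longrightarrow> x \<sqinter> y \<sqsubseteq> z"
  by (meson le_trans meet_closed meet_left)

lemma meet_le_right:
  "\<lbrakk>y \<sqsubseteq> z; x \<in> carrier L; y \<in> carrier L; z \<in> carrier L\<rbrakk> \<Longrightarrow> x \<sqinter> y \<sqsubseteq> z"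
  by (meson le_trans meet_closed meet_right)

lemma le_join_left:
  "\<lbrakk>z \<sqsubseteq> x; x \<in> carrier L; y \<in> carrier L; z \<in> carrier L\<rbrakk> \<Longrightarrow> z \<sqsubseteq> x \<squnion> y"
  by (meson le_trans join_closed join_left)

lemma le_join_right:
  "\<lbrakk>z \<sqsubseteq> y; x \<in> carrier L; y \<in> carrier L; z \<in> carrier L\<rbrakk> \<Longrightarrow> z \<sqsubseteq> x \<squnion> y"
  by (meson le_trans join_closed join_right)

lemma meet_mono:
  "\<lbrakk>x \<sqsubseteq> x'; y \<sqsubseteq> y'; x \<in> carrier L; y \<in> carrier L; x' \<in> carrier L; y' \<in> carrier L\<rbrakk>
    \<Longrightarrow> x \<sqinter> y \<sqsubseteq> x' \<sqinter> y'"
  by (simp add: le_meet_iff meet_le_left meet_le_right)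

lemma join_mono:
  "\<lbrakk>x \<sqsubseteq> x'; y \<sqsubseteq> y'; x \<in> carrier L; y \<in> carrier L; x' \<in> carrier L; y' \<in> carrier L\<rbrakk>
    \<Longrightarrow> x \<squnion> y \<sqsubseteq> x' \<squnion> y'"
  by (simp add: join_le_iff le_join_left le_join_right)

lemma meet_absorb:
  "\<lbrakk>x \<sqsubseteq> y; x \<in> carrier L; y \<in> carrier L\<rbrakk> \<Longrightarrow> x \<sqinter> y = x"
  using le_iff_join by simp

end

subsection \<open>Filters\<close>

definition lattice_filter :: "('a, 'b) gorder_scheme \<Rightarrow> 'a set \<Rightarrow> bool" where
  "lattice_filter L F \<longleftrightarrow> F \<subseteq> carrier L \<and> \<top>\<^bsub>L\<^esub> \<in> F
    \<and> (\<forall>x \<in> F. \<forall>y \<in> carrier L. x \<sqsubseteq>\<^bsub>L\<^esub> y \<longrightarrow> y \<in> F)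
    \<and> (\<forall>x \<in> F. \<forall>y \<in> F. x \<sqinter>\<^bsub>L\<^esub> y \<in> F)"

definition prime_filter :: "('a, 'b) gorder_scheme \<Rightarrow> 'a set \<Rightarrow> bool" where
  "prime_filter L F \<longleftrightarrow> lattice_filter L F \<and> \<bottom>\<^bsub>L\<^esub> \<notin> F
    \<and> (\<forall>x \<in> carrier L. \<forall>y \<in> carrier L. x \<squnion>\<^bsub>L\<^esub> y \<in> F \<longrightarrow> x \<in> F \<or> y \<in> F)"

text \<open>For a filter \<open>F\<close> this is the filter generated by \<open>F\<close> and
  \<open>a\<close>; a single \<open>f\<close> suffices because \<open>F\<close> is closed under
  meets.\<close>

definition adjoin :: "('a, 'b) gorder_scheme \<Rightarrow> 'a set \<Rightarrow> 'a \<Rightarrow> 'a set" where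
  "adjoin L F a = {y \<in> carrier L. \<exists>f \<in> F. f \<sqinter>\<^bsub>L\<^esub> a \<sqsubseteq>\<^bsub>L\<^esub> y}"

lemma lattice_filterD:
  fixes L (structure)
  assumes "lattice_filter L F"
  shows "x \<in> F \<Longrightarrow> x \<in> carrier L"
    and "\<top> \<in> F"
    and "\<lbrakk>x \<in> F; x \<sqsubseteq> y; y \<in> carrier L\<rbrakk> \<Longrightarrow> y \<in> F"
    and "\<lbrakk>x \<in> F; y \<in> F\<rbrakk> \<Longrightarrow> x \<sqinter> y \<in> F"
  using assms unfolding lattice_filter_def by blast+

lemma prime_filterD:
  fixes L (structure)
  assumes "prime_filter L F"
  shows "lattice_filter L F" and "\<bottom> \<notin> F"
    and "\<lbrakk>x \<squnion> y \<in> F; x \<in> carrier L; y \<in> carrier L\<rbrakk> \<Longrightarrow> x \<in> F \<or> y \<in> F"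
  using assms unfolding prime_filter_def by blast+

context bounded_lattice
begin

lemma meet_in_filter_iff:
  assumes "lattice_filter L F" "x \<in> carrier L" "y \<in> carrier L"
  shows "x \<sqinter> y \<in> F \<longleftrightarrow> x \<in> F \<and> y \<in> F"
  using lattice_filterD(3)[OF assms(1) _ meet_left[OF assms(2,3)] assms(2)]
    lattice_filterD(3)[OF assms(1) _ meet_right[OF assms(2,3)] assms(3)]
    lattice_filterD(4)[OF assms(1), of x y] by blast

lemma join_in_prime_filter_iff:
  assumes "prime_filter L F" "x \<in> carrier L" "y \<in> carrier L"
  shows "x \<squnion> y \<in> F \<longleftrightarrow> x \<in> F \<or> y \<in> F"
proof -
  note up = lattice_filterD(3)[OF prime_filterD(1)[OF assms(1)]]
  show ?thesis
    using up[OF _ join_left[OF assms(2,3)]] up[OF _ join_right[OF assms(2,3)]]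
      prime_filterD(3)[OF assms(1), of x y] assms by auto
qed

lemma principal_filter:
  assumes "a \<in> carrier L"
  shows "lattice_filter L {x \<in> carrier L. a \<sqsubseteq> x}"
  unfolding lattice_filter_def
proof (intro conjI ballI impI)
  fix x y
  assume "x \<in> {x \<in> carrier L. a \<sqsubseteq> x}" "y \<in> carrier L" "x \<sqsubseteq> y"
  then show "y \<in> {x \<in> carrier L. a \<sqsubseteq> x}"
    using le_trans[of a x y] assms by simp
qed (use assms in \<open>auto simp: le_meet_iff\<close>)

lemma adjoin_filter:
  assumes F: "lattice_filter L F" and a: "a \<in> carrier L"
  shows "lattice_filter L (adjoin L F a)" and "F \<subseteq> adjoin L F a" and "a \<in> adjoin L F a"
proof -
  note [simp] = lattice_filterD(1)[OF F]
  show "F \<subseteq> adjoin L F a"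
  proof
    fix x assume "x \<in> F"
    then show "x \<in> adjoin L F a"
      using a meet_left[of x a] by (auto simp: adjoin_def)
  qed
  show "a \<in> adjoin L F a"
    using a lattice_filterD(2)[OF F] meet_right[of \<top> a] by (auto simp: adjoin_def)
  have "y \<sqinter> z \<in> adjoin L F a" if y: "y \<in> adjoin L F a" and z: "z \<in> adjoin L F a" for y z
  proof -
    obtain f g where fg: "f \<in> F" "f \<sqinter> a \<sqsubseteq> y" "g \<in> F" "g \<sqinter> a \<sqsubseteq> z"
      and yz: "y \<in> carrier L" "z \<in> carrier L"
      using y z by (auto simp: adjoin_def)
    have "f \<sqinter> g \<sqinter> a \<sqsubseteq> f \<sqinter> a" "f \<sqinter> g \<sqinter> a \<sqsubseteq> g \<sqinter> a"
      using fg a by (auto intro!: meet_mono meet_left meet_right)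
    then have "f \<sqinter> g \<sqinter> a \<sqsubseteq> y" "f \<sqinter> g \<sqinter> a \<sqsubseteq> z"
      using le_trans[of "f \<sqinter> g \<sqinter> a" "f \<sqinter> a" y] le_trans[of "f \<sqinter> g \<sqinter> a" "g \<sqinter> a" z] fg a yz
      by simp_all
    then show ?thesis
      using fg a yz lattice_filterD(4)[OF F]
      by (auto simp: adjoin_def le_meet_iff intro!: bexI[of _ "f \<sqinter> g"])
  qed
  moreover have "z \<in> adjoin L F a" if yz: "y \<in> adjoin L F a" "z \<in> carrier L" "y \<sqsubseteq> z" for y z
  proof -
    obtain f where "f \<in> F" "f \<sqinter> a \<sqsubseteq> y" "y \<in> carrier L" using yz(1) by (auto simp: adjoin_def)
    moreover from this have "f \<sqinter> a \<sqsubseteq> z" using yz a le_trans[of "f \<sqinter> a" y z] by simp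
    ultimately show ?thesis using yz by (auto simp: adjoin_def)
  qed
  moreover have "\<top> \<in> adjoin L F a"
    using \<open>F \<subseteq> adjoin L F a\<close> lattice_filterD(2)[OF F] by blast
  ultimately show "lattice_filter L (adjoin L F a)"
    unfolding lattice_filter_def by (auto simp: adjoin_def)
qed

text \<open>A filter maximal among those that extend \<open>F\<close> and omit \<open>b\<close> is
  prime. The usual argument distributes a meet over a join only once, below elements of the filter
  and on the way to \<open>b\<close>, so distributivity up to some \<open>f \<in> F\<close> and up
  to joining \<open>b\<close> is enough.\<close>

lemma prime_filter_extension:
  assumes F: "lattice_filter L F" and b: "b \<in> carrier L" "b \<notin> F"
    and dist: "\<And>g c d. \<lbrakk>g \<in> carrier L; c \<in> carrier L; d \<in> carrier L\<rbrakk>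
      \<Longrightarrow> \<exists>f \<in> F. f \<sqinter> (g \<sqinter> (c \<squnion> d)) \<sqsubseteq> ((g \<sqinter> c) \<squnion> (g \<sqinter> d)) \<squnion> b"
  obtains G where "prime_filter L G" "F \<subseteq> G" "b \<notin> G"
proof -
  let ?A = "{G. lattice_filter L G \<and> F \<subseteq> G \<and> b \<notin> G}"
  have "\<exists>M \<in> ?A. \<forall>X \<in> ?A. M \<subseteq> X \<longrightarrow> X = M"
  proof (rule subset_Zorn_nonempty)
    show "?A \<noteq> {}" using F b by blast
  next
    fix C assume C: "C \<noteq> {}" "subset.chain ?A C"
    then have flt: "\<And>G. G \<in> C \<Longrightarrow> lattice_filter L G \<and> F \<subseteq> G \<and> b \<notin> G"
      and lin: "\<And>G H. \<lbrakk>G \<in> C; H \<in> C\<rbrakk> \<Longrightarrow> G \<subseteq> H \<or> H \<subseteq> G"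
      by (auto simp: subset_chain_def)
    have "x \<sqinter> y \<in> \<Union>C" if xy: "x \<in> \<Union>C" "y \<in> \<Union>C" for x y
    proof -
      obtain G H where GH: "G \<in> C" "x \<in> G" "H \<in> C" "y \<in> H" using xy by auto
      then have "x \<sqinter> y \<in> G \<or> x \<sqinter> y \<in> H"
        using lin[of G H] flt[of G] flt[of H] lattice_filterD(4)[of L] by (metis subsetD)
      then show ?thesis using GH by blast
    qed
    moreover have "\<Union>C \<subseteq> carrier L"
      using flt by (auto dest: lattice_filterD(1))
    moreover have "\<top> \<in> \<Union>C"
      using C flt by (auto dest: lattice_filterD(2))
    moreover have "y \<in> \<Union>C" if "x \<in> \<Union>C" "y \<in> carrier L" "x \<sqsubseteq> y" for x y
      using that flt by (auto dest: lattice_filterD(3))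
    ultimately have "lattice_filter L (\<Union>C)"
      unfolding lattice_filter_def by blast
    then show "\<Union>C \<in> ?A"
      using C flt by blast
  qed
  then obtain M where M: "lattice_filter L M" "F \<subseteq> M" "b \<notin> M"
    and max: "\<And>X. \<lbrakk>lattice_filter L X; M \<subseteq> X; b \<notin> X\<rbrakk> \<Longrightarrow> X = M"
    by auto
  note [simp] = lattice_filterD(1)[OF M(1)]
  \<comment> \<open>By maximality, adjoining any \<open>c\<close> outside \<open>M\<close> forces
    \<open>b\<close> into the generated filter.\<close>
  have reach: "\<exists>g \<in> M. g \<sqinter> c \<sqsubseteq> b" if "c \<in> carrier L" "c \<notin> M" for c
    using max[of "adjoin L M c"] adjoin_filter[OF M(1) that(1)] that(2)
    by (auto simp: adjoin_def)
  have "c \<in> M \<or> d \<in> M" if cd: "c \<in> carrier L" "d \<in> carrier L" "c \<squnion> d \<in> M" for c d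
  proof (rule ccontr)
    assume "\<not> (c \<in> M \<or> d \<in> M)"
    then obtain g h where gh: "g \<in> M" "g \<sqinter> c \<sqsubseteq> b" "h \<in> M" "h \<sqinter> d \<sqsubseteq> b"
      using reach[OF cd(1)] reach[OF cd(2)] by auto
    then have [simp]: "g \<in> carrier L" "h \<in> carrier L" by simp_all
    \<comment> \<open>With the common witness \<open>g \<sqinter> h\<close>, both terms of the
      distributed join fall below \<open>b\<close>, so the whole right-hand side collapses to
      \<open>b\<close>.\<close>
    obtain f where f: "f \<in> F"
      "f \<sqinter> ((g \<sqinter> h) \<sqinter> (c \<squnion> d)) \<sqsubseteq> (((g \<sqinter> h) \<sqinter> c) \<squnion> ((g \<sqinter> h) \<sqinter> d)) \<squnion> b"
      using dist[of "g \<sqinter> h" c d] cd by (meson meet_closed \<open>g \<in> carrier L\<close> \<open>h \<in> carrier L\<close>)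
    have "(g \<sqinter> h) \<sqinter> c \<sqsubseteq> g \<sqinter> c" "(g \<sqinter> h) \<sqinter> d \<sqsubseteq> h \<sqinter> d"
      using gh cd by (auto intro!: meet_mono meet_left meet_right)
    then have "(g \<sqinter> h) \<sqinter> c \<sqsubseteq> b" "(g \<sqinter> h) \<sqinter> d \<sqsubseteq> b"
      using le_trans[of "g \<sqinter> h \<sqinter> c" "g \<sqinter> c" b] le_trans[of "g \<sqinter> h \<sqinter> d" "h \<sqinter> d" b] gh cd b
      by simp_all
    then have le_b: "(((g \<sqinter> h) \<sqinter> c) \<squnion> ((g \<sqinter> h) \<sqinter> d)) \<squnion> b \<sqsubseteq> b"
      using cd b by (simp add: join_le_iff)
    have "f \<in> M" using f M by blast
    then have "f \<sqinter> ((g \<sqinter> h) \<sqinter> (c \<squnion> d)) \<in> M"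
      using gh cd by (simp add: meet_in_filter_iff[OF M(1)])
    moreover have "f \<sqinter> ((g \<sqinter> h) \<sqinter> (c \<squnion> d)) \<sqsubseteq> b"
      using le_trans[OF f(2) le_b] \<open>f \<in> M\<close> cd b by simp
    ultimately have "b \<in> M"
      using b(1) by (rule lattice_filterD(3)[OF M(1)])
    then show False using M by blast
  qed
  moreover have "\<bottom> \<notin> M"
    using lattice_filterD(3)[OF M(1), of \<bottom> b] M(3) b bottom_lower by auto
  ultimately have "prime_filter L M"
    using M(1) by (simp add: prime_filter_def)
  then show thesis using M(2,3) by (rule that)
qed

end

subsection \<open>Homomorphisms and countable subalgebras\<close>

text \<open>Preservation of the operations is what commuting with \<open>eval\<close> takes. The
  locale thus covers the two quotient maps of the final argument as well as inclusions of
  subalgebras.\<close>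

locale imp_hom = bounded_lattice K
  for K :: "('a, 'c) imp_algebra_scheme" (structure) +
  fixes L :: "('b, 'd) imp_algebra_scheme" and h :: "'a \<Rightarrow> 'b"
  assumes hom_imp_closed: "\<lbrakk>x \<in> carrier K; y \<in> carrier K\<rbrakk> \<Longrightarrow> x \<leadsto> y \<in> carrier K"
    and hom_bottom: "h \<bottom> = \<bottom>\<^bsub>L\<^esub>"
    and hom_top: "h \<top> = \<top>\<^bsub>L\<^esub>"
    and hom_meet: "\<lbrakk>x \<in> carrier K; y \<in> carrier K\<rbrakk> \<Longrightarrow> h (x \<sqinter> y) = h x \<sqinter>\<^bsub>L\<^esub> h y"
    and hom_join: "\<lbrakk>x \<in> carrier K; y \<in> carrier K\<rbrakk> \<Longrightarrow> h (x \<squnion> y) = h x \<squnion>\<^bsub>L\<^esub> h y"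
    and hom_imp: "\<lbrakk>x \<in> carrier K; y \<in> carrier K\<rbrakk> \<Longrightarrow> h (x \<leadsto> y) = (h x \<leadsto>\<^bsub>L\<^esub> h y)"
begin

lemma eval_in_carrier:
  assumes "\<And>p. v p \<in> carrier K"
  shows "eval K v \<chi> \<in> carrier K"
  by (induction \<chi>) (use assms hom_imp_closed in auto)

lemma eval_hom:
  assumes "\<And>p. v p \<in> carrier K"
  shows "h (eval K v \<chi>) = eval L (h \<circ> v) \<chi>"
proof -
  note [simp] = eval_in_carrier[of v, OF assms]
  show ?thesis
    by (induction \<chi>) (simp_all add: hom_bottom hom_top hom_meet hom_join hom_imp)
qed

end

text \<open>Every class of algebras considered is given by universal conditions on the order and the
  operations. A map that preserves the operations and reflects the order therefore pulls each class
  back from \<open>L\<close> to \<open>K\<close>.\<close>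

locale imp_embedding = imp_hom K L h
  for K :: "('a, 'c) imp_algebra_scheme" (structure)
    and L :: "('b, 'd) imp_algebra_scheme" and h :: "'a \<Rightarrow> 'b" +
  assumes emb_closed: "x \<in> carrier K \<Longrightarrow> h x \<in> carrier L"
    and emb_le: "\<lbrakk>x \<in> carrier K; y \<in> carrier K\<rbrakk> \<Longrightarrow> x \<sqsubseteq> y \<longleftrightarrow> h x \<sqsubseteq>\<^bsub>L\<^esub> h y"
begin

lemma emb_eq:
  assumes "partial_order L" "x \<in> carrier K" "y \<in> carrier K"
  shows "x = y \<longleftrightarrow> h x = h y"
  using assms emb_closed emb_le le_antisym le_refl by metis

lemma hom_neg: "x \<in> carrier K \<Longrightarrow> h (\<sim>x) = \<sim>\<^bsub>L\<^esub> (h x)"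
  by (simp add: neg_def hom_imp hom_bottom)

lemma neg_in_carrier: "x \<in> carrier K \<Longrightarrow> \<sim>x \<in> carrier K"
  by (simp add: neg_def hom_imp_closed)

lemmas embs = hom_bottom hom_top hom_meet hom_join hom_imp hom_neg neg_in_carrier
  hom_imp_closed emb_closed

lemma fundamental:
  assumes "fundamental_algebra L"
  shows "fundamental_algebra K"
proof -
  interpret L: fundamental_algebra L by fact
  note eqs = emb_eq[OF L.partial_order_axioms]
  show ?thesis
    by unfold_locales
      (simp_all add: embs emb_le eqs L.neg_antitone L.meet_neg L.le_neg_neg)
qed

lemma heyting:
  assumes "heyting_algebra L"
  shows "heyting_algebra K"
proof -
  interpret L: heyting_algebra L by fact
  interpret K: fundamental_algebra K by (rule fundamental) (rule L.fundamental_algebra_axioms)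
  show ?thesis
    by unfold_locales (simp add: embs emb_le L.residuation)
qed

lemma orthomodular:
  assumes "orthomodular_algebra L"
  shows "orthomodular_algebra K"
proof -
  interpret L: orthomodular_algebra L by fact
  interpret K: fundamental_algebra K by (rule fundamental) (rule L.fundamental_algebra_axioms)
  note eqs = emb_eq[OF L.partial_order_axioms]
  show ?thesis
    by unfold_locales (simp_all add: embs emb_le eqs L.neg_neg L.modus_ponens L.sasaki[symmetric])
qed

lemma joint:
  assumes "joint_algebra L"
  shows "joint_algebra K"
proof -
  interpret L: joint_algebra L by fact
  interpret K: fundamental_algebra K by (rule fundamental) (rule L.fundamental_algebra_axioms)
  note eqs = emb_eq[OF L.partial_order_axioms]
  show ?thesis
    by unfold_locales
      (simp_all add: embs emb_le eqs L.nS L.MP L.M L.W4 L.iCl1 L.iCl2 L.Nu L.Vi)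
qed

end

section \<open>Passage to a countable generated subalgebra\<close>

instance form :: (countable) countable
  by countable_datatype

lemma eval_cong: "(\<And>p. p \<in> set_form \<chi> \<Longrightarrow> v p = w p) \<Longrightarrow> eval L v \<chi> = eval L w \<chi>"
  by (induction \<chi>) auto

lemma finite_set_form: "finite (set_form \<chi>)"
  by (induction \<chi>) auto

text \<open>Makes \<open>eval_in_carrier\<close> available for a single algebra.\<close>

lemma (in fundamental_algebra) id_hom: "imp_hom L L id"
  by unfold_locales (simp_all add: imp_closed)

text \<open>Only finitely many variables matter, so the subalgebra generated by their values is the set
  of values of formulas over countably many variables.\<close>

lemma valid_in_transfer:
  fixes L :: "('a, 'c) imp_algebra_scheme" and \<phi> \<psi> :: "'v form"
  assumes "fundamental_algebra L"
    and inf: "infinite (UNIV :: 'b set)"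
    and valid: "\<And>(K :: 'b imp_algebra) e. imp_embedding K L e \<Longrightarrow> valid_in K \<phi> \<psi>"
  shows "valid_in L \<phi> \<psi>"
proof (rule ccontr)
  assume inv: "\<not> valid_in L \<phi> \<psi>"
  interpret L: fundamental_algebra L by fact
  interpret id: imp_hom L L id by (rule L.id_hom)
  obtain v where v: "\<And>p. v p \<in> carrier L" and nle: "\<not> eval L v \<phi> \<sqsubseteq>\<^bsub>L\<^esub> eval L v \<psi>"
    using inv by (auto simp: valid_in_def)
  define A where "A = set_form \<phi> \<union> set_form \<psi>"
  have "finite A" by (simp add: A_def finite_set_form)
  then obtain f :: "'v \<Rightarrow> nat" where f: "inj_on f A"
    using finite_imp_inj_to_nat_seg by metis
  \<comment> \<open>Renames the variables to natural numbers. Outside the image of \<open>A\<close>,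
    \<open>inv_into\<close> returns an arbitrary variable, which is harmless because
    \<open>v\<close> takes all its values in the carrier.\<close>
  define w where "w n = v (inv_into A f n)" for n
  have w: "w n \<in> carrier L" for n by (simp add: w_def v)
  have eval_w: "eval L (w \<circ> f) \<chi> = eval L v \<chi>" if "set_form \<chi> \<subseteq> A" for \<chi>
    by (rule eval_cong) (use that f in \<open>auto simp: w_def\<close>)
  define S where "S = range (\<lambda>\<chi> :: nat form. eval L w \<chi>)"
  have "countable S" by (simp add: S_def)
  \<comment> \<open>The infinite type \<open>'b\<close> has room for a copy of the countable set
    \<open>S\<close>: \<open>g\<close> encodes and \<open>e\<close> decodes.\<close>
  obtain k :: "nat \<Rightarrow> 'b" where "inj k"
    using infinite_countable_subset[OF inf] by blast
  define g where "g = k \<circ> to_nat_on S"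
  have g: "inj_on g S"
    unfolding g_def using \<open>countable S\<close> \<open>inj k\<close>
    by (intro comp_inj_on) (auto intro: inj_on_subset)
  define e where "e = inv_into S g"
  have e_g [simp]: "e (g x) = x" if "x \<in> S" for x
    using that g by (simp add: e_def)
  have SL: "x \<in> carrier L" if "x \<in> S" for x
    using that id.eval_in_carrier w unfolding S_def by blast
  have S_ops: "\<bottom>\<^bsub>L\<^esub> \<in> S" "\<top>\<^bsub>L\<^esub> \<in> S"
    "\<And>x y. \<lbrakk>x \<in> S; y \<in> S\<rbrakk> \<Longrightarrow> x \<sqinter>\<^bsub>L\<^esub> y \<in> S"
    "\<And>x y. \<lbrakk>x \<in> S; y \<in> S\<rbrakk> \<Longrightarrow> x \<squnion>\<^bsub>L\<^esub> y \<in> S"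
    "\<And>x y. \<lbrakk>x \<in> S; y \<in> S\<rbrakk> \<Longrightarrow> (x \<leadsto>\<^bsub>L\<^esub> y) \<in> S"
    unfolding S_def image_iff bex_UNIV by (metis eval.simps(2-6))+
  \<comment> \<open>The structure of \<open>L\<close> restricted to \<open>S\<close> is transported
    along \<open>g\<close>, which makes \<open>e\<close> an embedding.\<close>
  define K :: "'b imp_algebra" where "K = \<lparr>carrier = g ` S, eq = (=), le = (\<lambda>x y. e x \<sqsubseteq>\<^bsub>L\<^esub> e y),
    imp = (\<lambda>x y. g (e x \<leadsto>\<^bsub>L\<^esub> e y))\<rparr>"
  have e: "e x \<in> S" "e x \<in> carrier L" "g (e x) = x" if "x \<in> carrier K" for x
    using that SL by (auto simp: K_def)
  have g_carrier: "g x \<in> carrier K" if "x \<in> S" for x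
    using that by (simp add: K_def)
  have le_K: "x \<sqsubseteq>\<^bsub>K\<^esub> y \<longleftrightarrow> e x \<sqsubseteq>\<^bsub>L\<^esub> e y" for x y by (simp add: K_def)
  have eq_K: "(.=\<^bsub>K\<^esub>) = (=)" by (simp add: K_def)
  have imp_K: "(x \<leadsto>\<^bsub>K\<^esub> y) = g (e x \<leadsto>\<^bsub>L\<^esub> e y)" for x y by (simp add: K_def)
  have antisym: "x = y" if "x \<in> carrier K" "y \<in> carrier K" "x \<sqsubseteq>\<^bsub>K\<^esub> y" "y \<sqsubseteq>\<^bsub>K\<^esub> x" for x y
  proof -
    have "e x = e y"
      by (rule L.le_antisym) (use that e(2) in \<open>simp_all add: le_K\<close>)
    then have "g (e x) = g (e y)" by (rule arg_cong)
    then show ?thesis by (simp only: e(3)[OF that(1)] e(3)[OF that(2)])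
  qed
  have trans: "x \<sqsubseteq>\<^bsub>K\<^esub> z"
    if "x \<in> carrier K" "y \<in> carrier K" "z \<in> carrier K" "x \<sqsubseteq>\<^bsub>K\<^esub> y" "y \<sqsubseteq>\<^bsub>K\<^esub> z" for x y z
    unfolding le_K by (rule L.le_trans[of _ "e y"]) (use that e(2) in \<open>simp_all add: le_K\<close>)
  have K: "bounded_lattice K" "\<bottom>\<^bsub>K\<^esub> = g \<bottom>\<^bsub>L\<^esub>" "\<top>\<^bsub>K\<^esub> = g \<top>\<^bsub>L\<^esub>"
    "\<And>x y. \<lbrakk>x \<in> carrier K; y \<in> carrier K\<rbrakk> \<Longrightarrow> x \<sqinter>\<^bsub>K\<^esub> y = g (e x \<sqinter>\<^bsub>L\<^esub> e y)"
    "\<And>x y. \<lbrakk>x \<in> carrier K; y \<in> carrier K\<rbrakk> \<Longrightarrow> x \<squnion>\<^bsub>K\<^esub> y = g (e x \<squnion>\<^bsub>L\<^esub> e y)"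
    by (rule bounded_lattice_presentation[where L = K and z = "g \<bottom>\<^bsub>L\<^esub>" and t = "g \<top>\<^bsub>L\<^esub>"
          and m = "\<lambda>x y. g (e x \<sqinter>\<^bsub>L\<^esub> e y)" and j = "\<lambda>x y. g (e x \<squnion>\<^bsub>L\<^esub> e y)"];
        (rule antisym trans; assumption)?; simp add: eq_K g_carrier le_K e S_ops
          L.le_meet_iff L.join_le_iff L.bottom_lower L.top_higher)+
  interpret K: bounded_lattice K by (rule K)
  have emb: "imp_embedding K L e"
    by unfold_locales (simp_all add: K(2-5) imp_K S_ops e g_carrier le_K)
  then interpret emb: imp_embedding K L e .
  \<comment> \<open>The refuting valuation inside the copy: decoded, it is
    \<open>w \<circ> f\<close>, which agrees with \<open>v\<close> on the variables of both
    formulas.\<close>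
  define u where "u = g \<circ> w \<circ> f"
  have wS: "w n \<in> S" for n
    unfolding S_def by (metis eval.simps(1) rangeI)
  then have u: "u p \<in> carrier K" for p by (simp add: u_def g_carrier)
  have "e \<circ> u = w \<circ> f" using wS by (auto simp: u_def)
  then have "e (eval K u \<chi>) = eval L v \<chi>" if "set_form \<chi> \<subseteq> A" for \<chi>
    using emb.eval_hom[of u, OF u] eval_w[OF that] by simp
  then have "\<not> eval K u \<phi> \<sqsubseteq>\<^bsub>K\<^esub> eval K u \<psi>"
    using nle by (simp add: emb.emb_le emb.eval_in_carrier u A_def)
  then have "\<not> valid_in K \<phi> \<psi>"
    using u by (auto simp: valid_in_def)
  with valid[OF emb] show False by contradiction
qed

subsection \<open>Heyting and orthomodular algebras are joint algebras\<close>

context fundamental_algebra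
begin

lemma neg_closed [simp]: "a \<in> carrier L \<Longrightarrow> \<sim>a \<in> carrier L"
  by (simp add: neg_def imp_closed)

declare imp_closed [simp]

lemma neg_top: "\<sim>\<top> = \<bottom>"
  using meet_neg[of \<top>] le_iff_join[of "\<sim>\<top>" \<top>] by (simp add: meet_comm[of L] top_higher)

lemma neg_bottom: "\<sim>\<bottom> = \<top>"
  using le_neg_neg[of \<top>] by (simp add: neg_top top_le_iff)

lemma neg_neg_neg: "a \<in> carrier L \<Longrightarrow> \<sim>\<sim>\<sim>a = \<sim>a"
  by (rule le_antisym) (simp_all add: neg_antitone le_neg_neg)

text \<open>Antitonicity together with (iii) makes negation a Galois connection with itself, so it
  turns joins into meets.\<close>

lemma le_neg_iff:
  assumes "a \<in> carrier L" "b \<in> carrier L"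
  shows "a \<sqsubseteq> \<sim>b \<longleftrightarrow> b \<sqsubseteq> \<sim>a"
  using assms by (meson le_neg_neg le_trans neg_antitone neg_closed)

lemma le_neg_join_iff:
  assumes "a \<in> carrier L" "b \<in> carrier L" "w \<in> carrier L"
  shows "w \<sqsubseteq> \<sim>(a \<squnion> b) \<longleftrightarrow> w \<sqsubseteq> \<sim>a \<and> w \<sqsubseteq> \<sim>b"
  using assms by (simp add: le_neg_iff[of w] join_le_iff)

end

section \<open>Heyting algebras satisfy the joint axioms\<close>

lemma (in heyting_algebra) meet_join_distrib:
  assumes "a \<in> carrier L" "b \<in> carrier L" "c \<in> carrier L"
  shows "a \<sqinter> (b \<squnion> c) \<sqsubseteq> (a \<sqinter> b) \<squnion> (a \<sqinter> c)"
proof -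
  let ?r = "(a \<sqinter> b) \<squnion> (a \<sqinter> c)"
  \<comment> \<open>Meeting with \<open>a\<close> is left adjoint to implication from
    \<open>a\<close>, hence preserves joins.\<close>
  have "b \<sqsubseteq> a \<leadsto> ?r" "c \<sqsubseteq> a \<leadsto> ?r"
    using assms by (simp_all add: residuation[symmetric] meet_comm[of L _ a] join_left join_right)
  then have "b \<squnion> c \<sqsubseteq> a \<leadsto> ?r" using assms by (simp add: join_le_iff)
  then show ?thesis using assms by (simp add: residuation[symmetric] meet_comm[of L _ a])
qed

lemma (in heyting_algebra) le_neg_iff_meet:
  assumes "a \<in> carrier L" "w \<in> carrier L"
  shows "w \<sqsubseteq> \<sim>a \<longleftrightarrow> w \<sqinter> a \<sqsubseteq> \<bottom>"
  using assms by (simp add: neg_def residuation)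

text \<open>Modus ponens relative to a bound \<open>w\<close>, which plays the role of the current
  assumptions.\<close>

lemma (in heyting_algebra) mp_le:
  assumes "a \<in> carrier L" "b \<in> carrier L" "w \<in> carrier L" "w \<sqsubseteq> a" "w \<sqsubseteq> a \<leadsto> b"
  shows "w \<sqsubseteq> b"
proof -
  have "w \<sqinter> a \<sqsubseteq> b" using assms by (simp add: residuation)
  then show ?thesis using assms by (simp add: meet_absorb)
qed

text \<open>To prove a negation from a double negation of \<open>a\<close>, one may assume
  \<open>a\<close> itself: the case \<open>u = w \<sqinter> b \<sqinter> a\<close> is contradictory,
  so \<open>w \<sqinter> b\<close> lies below both \<open>\<sim>a\<close> and
  \<open>\<sim>\<sim>a\<close>.\<close>

lemma (in heyting_algebra) neg_neg_le:
  assumes "a \<in> carrier L" "b \<in> carrier L" "w \<in> carrier L"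
    and "w \<sqsubseteq> \<sim>\<sim>a" and "\<And>u. \<lbrakk>u \<in> carrier L; u \<sqsubseteq> w; u \<sqsubseteq> a\<rbrakk> \<Longrightarrow> u \<sqsubseteq> \<sim>b"
  shows "w \<sqsubseteq> \<sim>b"
proof -
  have *: "u \<sqsubseteq> \<bottom>" if "u \<sqsubseteq> a" "u \<sqsubseteq> \<sim>a" "u \<in> carrier L" "a \<in> carrier L" for u a
    using that mp_le[of a \<bottom> u] by (simp add: neg_def)
  have "w \<sqinter> b \<sqinter> a \<sqsubseteq> \<bottom>"
  proof (rule *[of _ b])
    show "w \<sqinter> b \<sqinter> a \<sqsubseteq> \<sim>b"
      using assms(1-4) by (intro assms(5)) (simp_all add: meet_le_left meet_le_right)
  qed (use assms(1-4) in \<open>simp_all add: meet_le_left meet_le_right\<close>)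
  then have "w \<sqinter> b \<sqsubseteq> \<sim>a" using assms by (simp add: le_neg_iff_meet)
  then have "w \<sqinter> b \<sqsubseteq> \<bottom>"
    using assms by (intro *[of _ "\<sim>a"]) (simp_all add: meet_le_left)
  then show ?thesis using assms by (simp add: le_neg_iff_meet)
qed

lemma (in heyting_algebra) weaken_imp:
  assumes "a \<in> carrier L" "b \<in> carrier L"
  shows "b \<sqsubseteq> a \<leadsto> b"
  using assms by (simp add: residuation[symmetric] meet_left)

lemma (in heyting_algebra) joint: "joint_algebra L"
proof unfold_locales
  fix a b c d
  assume [simp]: "a \<in> carrier L" "b \<in> carrier L" "c \<in> carrier L" "d \<in> carrier L"
  show "\<sim>(a \<leadsto> b) = \<sim>(\<sim>a \<squnion> (a \<sqinter> b))"
  proof (rule le_antisym)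
    have "\<sim>a \<sqinter> a \<sqsubseteq> b"
      by (simp add: meet_comm[of L "\<sim>a"] meet_neg bottom_lower)
    then have "\<sim>a \<sqsubseteq> a \<leadsto> b"
      by (simp add: residuation)
    moreover have "a \<sqinter> b \<sqsubseteq> a \<leadsto> b"
      by (simp add: residuation[symmetric] meet_le_left meet_right)
    ultimately show "\<sim>(a \<leadsto> b) \<sqsubseteq> \<sim>(\<sim>a \<squnion> (a \<sqinter> b))"
      by (simp add: neg_antitone join_le_iff)
  next
    \<comment> \<open>For the harder half of (nS), \<open>?w\<close> entails
      \<open>\<sim>\<sim>a\<close>, so \<open>a\<close> may be assumed; then
      \<open>a \<leadsto> b\<close> yields \<open>a \<sqinter> b\<close>, contradicting the second
      part of \<open>w\<close>.\<close>
    let ?w = "\<sim>(\<sim>a \<squnion> (a \<sqinter> b))"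
    have w: "?w \<sqsubseteq> \<sim>\<sim>a" "?w \<sqsubseteq> \<sim>(a \<sqinter> b)"
      using le_neg_join_iff[of "\<sim>a" "a \<sqinter> b" ?w] by simp_all
    show "?w \<sqsubseteq> \<sim>(a \<leadsto> b)"
    proof (rule neg_neg_le[of a])
      fix u assume u [simp]: "u \<in> carrier L" and "u \<sqsubseteq> ?w" "u \<sqsubseteq> a"
      then have ab: "u \<sqsubseteq> \<sim>(a \<sqinter> b)"
        using w(2) le_trans[of u ?w] by simp
      let ?x = "u \<sqinter> (a \<leadsto> b)"
      have "?x \<sqsubseteq> a" using \<open>u \<sqsubseteq> a\<close> by (simp add: meet_le_left)
      then have "?x \<sqsubseteq> b" using mp_le[of a b ?x] by (simp add: meet_right)
      then have "?x \<sqsubseteq> a \<sqinter> b" using \<open>?x \<sqsubseteq> a\<close> by (simp add: le_meet_iff)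
      moreover have "?x \<sqsubseteq> (a \<sqinter> b) \<leadsto> \<bottom>"
        using ab by (simp add: meet_le_left flip: neg_def)
      ultimately have "?x \<sqsubseteq> \<bottom>" using mp_le[of "a \<sqinter> b" \<bottom> ?x] by simp
      then show "u \<sqsubseteq> \<sim>(a \<leadsto> b)" by (simp add: le_neg_iff_meet)
    qed (use w in simp_all)
  qed simp_all
  show "a \<sqinter> (a \<leadsto> b) = a \<sqinter> b"
  proof (rule le_antisym)
    show "a \<sqinter> (a \<leadsto> b) \<sqsubseteq> a \<sqinter> b"
      using mp_le[of a b "a \<sqinter> (a \<leadsto> b)"] by (simp add: le_meet_iff meet_left meet_right)
    show "a \<sqinter> b \<sqsubseteq> a \<sqinter> (a \<leadsto> b)"
      using weaken_imp[of a b] by (simp add: meet_mono)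
  qed simp_all
  show "((a \<sqinter> b) \<leadsto> b) = \<top>"
    by (simp add: residuation[symmetric] meet_le_right meet_right flip: top_le_iff)
  show "(a \<leadsto> (b \<sqinter> c)) \<sqsubseteq> (a \<leadsto> b)"
  proof -
    have "(a \<leadsto> (b \<sqinter> c)) \<sqinter> a \<sqsubseteq> b \<sqinter> c"
      by (simp add: residuation)
    then show ?thesis by (simp add: residuation[symmetric] le_meet_iff)
  qed
  show "a \<sqinter> ((a \<sqinter> b) \<leadsto> c) \<sqsubseteq> b \<squnion> (b \<leadsto> c)"
  proof -
    \<comment> \<open>The left-hand side of (iCl1) with \<open>b\<close> assumed in addition: it
      entails \<open>c\<close>, so the second disjunct alone is a bound.\<close>
    let ?w = "a \<sqinter> ((a \<sqinter> b) \<leadsto> c) \<sqinter> b"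
    have "?w \<sqsubseteq> c"
      using mp_le[of "a \<sqinter> b" c ?w]
      by (simp add: le_meet_iff meet_le_left meet_left meet_right)
    then show ?thesis by (simp add: le_join_right residuation[symmetric])
  qed
  show "(((b \<sqinter> c) \<squnion> (b \<sqinter> d)) \<leadsto> a) \<sqsubseteq> (b \<sqinter> (c \<squnion> d)) \<squnion> ((b \<sqinter> (c \<squnion> d)) \<leadsto> a)"
  proof -
    \<comment> \<open>Distributivity turns the larger antecedent into \<open>?r\<close>, so again
      the second disjunct alone is a bound.\<close>
    let ?r = "(b \<sqinter> c) \<squnion> (b \<sqinter> d)"
    let ?w = "(?r \<leadsto> a) \<sqinter> (b \<sqinter> (c \<squnion> d))"
    have "?w \<sqsubseteq> ?r"
      using meet_join_distrib[of b c d] by (simp add: meet_le_right)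
    then have "?w \<sqsubseteq> a"
      using mp_le[of ?r a ?w] by (simp add: meet_left)
    then show ?thesis by (simp add: le_join_right residuation[symmetric])
  qed
  show "\<sim>\<sim>a \<sqinter> \<sim>\<sim>b \<sqsubseteq> \<sim>\<sim>(a \<sqinter> b)"
  \<comment> \<open>For (Nu), the double negations are eliminated one after the other, first on
    \<open>a\<close> and then on \<open>b\<close>.\<close>
  proof (rule neg_neg_le[of a])
    fix u assume u: "u \<in> carrier L" "u \<sqsubseteq> \<sim>\<sim>a \<sqinter> \<sim>\<sim>b" "u \<sqsubseteq> a"
    show "u \<sqsubseteq> \<sim>\<sim>(a \<sqinter> b)"
    proof (rule neg_neg_le[of b])
      fix x assume x: "x \<in> carrier L" "x \<sqsubseteq> u" "x \<sqsubseteq> b"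
      then have "x \<sqsubseteq> a \<sqinter> b"
        using u le_trans[of x u a] by (simp add: le_meet_iff)
      then show "x \<sqsubseteq> \<sim>\<sim>(a \<sqinter> b)"
        using x le_neg_neg[of "a \<sqinter> b"] le_trans[of x "a \<sqinter> b"] by simp
    qed (use u in \<open>simp_all add: le_meet_iff\<close>)
  qed (simp_all add: meet_left)
  show "a \<sqinter> (b \<squnion> c) \<sqinter> \<sim>\<sim>d \<sqsubseteq> (a \<sqinter> b) \<squnion> (a \<sqinter> c) \<squnion> d"
    using meet_join_distrib[of a b c] by (simp add: meet_le_left le_join_left)
qed

section \<open>Orthomodular algebras satisfy the joint axioms\<close>

lemma (in orthomodular_algebra) join_neg:
  assumes "a \<in> carrier L"
  shows "a \<squnion> \<sim>a = \<top>"
proof -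
  \<comment> \<open>Excluded middle is noncontradiction read through De Morgan and
    involution.\<close>
  have "\<sim>(a \<squnion> \<sim>a) \<sqsubseteq> \<sim>a \<sqinter> \<sim>\<sim>a"
    using assms le_neg_join_iff[of a "\<sim>a" "\<sim>(a \<squnion> \<sim>a)"] by (simp add: le_meet_iff)
  then have "\<sim>(a \<squnion> \<sim>a) = \<bottom>"
    using assms by (simp add: meet_neg le_bottom_iff)
  then show ?thesis
    using assms neg_neg[of "a \<squnion> \<sim>a"] neg_bottom by simp
qed

lemma (in orthomodular_algebra) joint: "joint_algebra L"
proof unfold_locales
  fix a b c d
  assume [simp]: "a \<in> carrier L" "b \<in> carrier L" "c \<in> carrier L" "d \<in> carrier L"
  show "\<sim>(a \<leadsto> b) = \<sim>(\<sim>a \<squnion> (a \<sqinter> b))"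
    by (simp add: sasaki)
  have "a \<sqinter> b \<sqsubseteq> a \<leadsto> b"
    by (simp add: sasaki join_right)
  then show "a \<sqinter> (a \<leadsto> b) = a \<sqinter> b"
    by (intro le_antisym)
      (simp_all add: le_meet_iff meet_left modus_ponens)
  have "(a \<sqinter> b) \<sqinter> b = a \<sqinter> b"
    by (simp add: meet_absorb meet_right)
  then show "((a \<sqinter> b) \<leadsto> b) = \<top>"
    by (simp add: sasaki join_neg join_comm[of L "\<sim>(a \<sqinter> b)"])
  show "(a \<leadsto> (b \<sqinter> c)) \<sqsubseteq> (a \<leadsto> b)"
    by (simp add: sasaki join_mono meet_mono meet_left)
  \<comment> \<open>The Sasaki implication lies above \<open>\<sim>x\<close>, so excluded middle
    makes this join the top. The right-hand sides of (iCl1) and (iCl2) are of this form.\<close>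
  have em: "x \<squnion> (x \<leadsto> y) = \<top>" if [simp]: "x \<in> carrier L" "y \<in> carrier L" for x y
  proof -
    have "x \<squnion> \<sim>x \<sqsubseteq> x \<squnion> (x \<leadsto> y)"
      by (simp add: sasaki join_mono join_left)
    then show ?thesis by (simp add: join_neg top_le_iff)
  qed
  show "a \<sqinter> ((a \<sqinter> b) \<leadsto> c) \<sqsubseteq> b \<squnion> (b \<leadsto> c)"
    by (simp add: em top_higher)
  show "(((b \<sqinter> c) \<squnion> (b \<sqinter> d)) \<leadsto> a) \<sqsubseteq> (b \<sqinter> (c \<squnion> d)) \<squnion> ((b \<sqinter> (c \<squnion> d)) \<leadsto> a)"
    by (simp add: em top_higher)
  show "\<sim>\<sim>a \<sqinter> \<sim>\<sim>b \<sqsubseteq> \<sim>\<sim>(a \<sqinter> b)"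
    by (simp add: neg_neg)
  show "a \<sqinter> (b \<squnion> c) \<sqinter> \<sim>\<sim>d \<sqsubseteq> (a \<sqinter> b) \<squnion> (a \<sqinter> c) \<squnion> d"
    by (simp add: neg_neg le_join_right meet_right)
qed

subsection \<open>The orthomodular quotient\<close>

text \<open>The analogue of the Boolean algebra of regular elements of a Heyting algebra. The outer
  double negation makes the carrier closed under implication.\<close>

definition regular_algebra :: "('a, 'b) imp_algebra_scheme \<Rightarrow> 'a imp_algebra" where
  "regular_algebra L = \<lparr>carrier = {a \<in> carrier L. \<sim>\<^bsub>L\<^esub>\<sim>\<^bsub>L\<^esub>a = a}, eq = (=), le = le L,
    imp = (\<lambda>a b. \<sim>\<^bsub>L\<^esub>\<sim>\<^bsub>L\<^esub>(a \<leadsto>\<^bsub>L\<^esub> b))\<rparr>"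

context joint_algebra
begin

lemma neg_neg_mono:
  "\<lbrakk>a \<sqsubseteq> b; a \<in> carrier L; b \<in> carrier L\<rbrakk> \<Longrightarrow> \<sim>\<sim>a \<sqsubseteq> \<sim>\<sim>b"
  by (simp add: neg_antitone)

lemma neg_neg_meet:
  assumes "a \<in> carrier L" "b \<in> carrier L"
  shows "\<sim>\<sim>(a \<sqinter> b) = \<sim>\<sim>a \<sqinter> \<sim>\<sim>b"
  by (rule le_antisym)
    (use assms in \<open>simp_all add: Nu le_meet_iff neg_neg_mono meet_left meet_right\<close>)

text \<open>Both sides have the same lower bounds, since negation turns joins into meets and triple
  negation is negation.\<close>

lemma neg_join_neg_neg:
  assumes [simp]: "a \<in> carrier L" "b \<in> carrier L"
  shows "\<sim>(\<sim>\<sim>a \<squnion> \<sim>\<sim>b) = \<sim>(a \<squnion> b)"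
proof -
  have "w \<sqsubseteq> \<sim>(\<sim>\<sim>a \<squnion> \<sim>\<sim>b) \<longleftrightarrow> w \<sqsubseteq> \<sim>(a \<squnion> b)" if "w \<in> carrier L" for w
    using that by (simp add: le_neg_join_iff neg_neg_neg)
  from this[of "\<sim>(\<sim>\<sim>a \<squnion> \<sim>\<sim>b)"] this[of "\<sim>(a \<squnion> b)"] show ?thesis
    by (intro le_antisym) simp_all
qed

text \<open>(nS) replaces the implication under a negation by a Sasaki term; its meet and join are
  compatible with double negation by the two preceding lemmas.\<close>

lemma neg_imp_neg_neg:
  assumes [simp]: "a \<in> carrier L" "b \<in> carrier L"
  shows "\<sim>(\<sim>\<sim>a \<leadsto> \<sim>\<sim>b) = \<sim>(a \<leadsto> b)"
  using neg_join_neg_neg[of "\<sim>a" "a \<sqinter> b"] by (simp add: nS neg_neg_meet neg_neg_neg)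

text \<open>Regular elements are closed under meets by (Nu), while the least regular upper bound of
  two elements is the double negation of their join.\<close>

lemma regular_algebra_lattice:
  defines "K \<equiv> regular_algebra L"
  shows "bounded_lattice K"
    and "\<bottom>\<^bsub>K\<^esub> = \<bottom>" and "\<top>\<^bsub>K\<^esub> = \<top>"
    and "\<And>x y. \<lbrakk>x \<in> carrier K; y \<in> carrier K\<rbrakk> \<Longrightarrow> x \<sqinter>\<^bsub>K\<^esub> y = x \<sqinter> y"
    and "\<And>x y. \<lbrakk>x \<in> carrier K; y \<in> carrier K\<rbrakk> \<Longrightarrow> x \<squnion>\<^bsub>K\<^esub> y = \<sim>\<sim>(x \<squnion> y)"
proof -
  have join: "\<sim>\<sim>(x \<squnion> y) \<sqsubseteq> w \<longleftrightarrow> x \<sqsubseteq> w \<and> y \<sqsubseteq> w"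
    if [simp]: "x \<in> carrier L" "y \<in> carrier L" "w \<in> carrier L" and w: "\<sim>\<sim>w = w" for x y w
  proof -
    have "\<sim>\<sim>(x \<squnion> y) \<sqsubseteq> w \<Longrightarrow> x \<squnion> y \<sqsubseteq> w"
      by (rule le_trans[of _ "\<sim>\<sim>(x \<squnion> y)"]) (simp_all add: le_neg_neg)
    moreover have "x \<squnion> y \<sqsubseteq> w \<Longrightarrow> \<sim>\<sim>(x \<squnion> y) \<sqsubseteq> w"
      using neg_neg_mono[of "x \<squnion> y" w] w by simp
    ultimately show ?thesis
      using join_le_iff[OF that(1,2,3)] by argo
  qed
  have K: "(.=\<^bsub>K\<^esub>) = (=)" "le K = le L" "\<And>x. x \<in> carrier K \<longleftrightarrow> x \<in> carrier L \<and> \<sim>\<sim>x = x"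
    by (simp_all add: K_def regular_algebra_def)
  have antisym: "x = y" if "x \<in> carrier K" "y \<in> carrier K" "x \<sqsubseteq>\<^bsub>K\<^esub> y" "y \<sqsubseteq>\<^bsub>K\<^esub> x" for x y
    by (rule le_antisym) (use that K in simp_all)
  have trans: "x \<sqsubseteq>\<^bsub>K\<^esub> z"
    if "x \<in> carrier K" "y \<in> carrier K" "z \<in> carrier K" "x \<sqsubseteq>\<^bsub>K\<^esub> y" "y \<sqsubseteq>\<^bsub>K\<^esub> z" for x y z
    unfolding K by (rule le_trans[of _ y]) (use that K in simp_all)
  show "bounded_lattice K" "\<bottom>\<^bsub>K\<^esub> = \<bottom>" "\<top>\<^bsub>K\<^esub> = \<top>"
    "\<And>x y. \<lbrakk>x \<in> carrier K; y \<in> carrier K\<rbrakk> \<Longrightarrow> x \<sqinter>\<^bsub>K\<^esub> y = x \<sqinter> y"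
    "\<And>x y. \<lbrakk>x \<in> carrier K; y \<in> carrier K\<rbrakk> \<Longrightarrow> x \<squnion>\<^bsub>K\<^esub> y = \<sim>\<sim>(x \<squnion> y)"
    by (rule bounded_lattice_presentation[where L = K and z = "\<bottom>" and t = "\<top>"
          and m = "\<lambda>x y. x \<sqinter> y" and j = "\<lambda>x y. \<sim>\<sim>(x \<squnion> y)"];
        (rule antisym trans; assumption)?; simp add: K neg_neg_meet neg_neg_neg le_meet_iff join
          neg_bottom neg_top bottom_lower top_higher)+
qed

lemma regular_algebra_carrier:
  "a \<in> carrier (regular_algebra L) \<longleftrightarrow> a \<in> carrier L \<and> \<sim>\<sim>a = a"
  by (simp add: regular_algebra_def)

lemma regular_algebra_le: "a \<sqsubseteq>\<^bsub>regular_algebra L\<^esub> b \<longleftrightarrow> a \<sqsubseteq> b"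
  by (simp add: regular_algebra_def)

lemma regular_algebra_imp: "(a \<leadsto>\<^bsub>regular_algebra L\<^esub> b) = \<sim>\<sim>(a \<leadsto> b)"
  by (simp add: regular_algebra_def)

lemma regular_algebra_neg:
  "a \<in> carrier L \<Longrightarrow> \<sim>\<^bsub>regular_algebra L\<^esub> a = \<sim>a"
  unfolding neg_def[of "regular_algebra L"] regular_algebra_imp regular_algebra_lattice(2)
  by (simp add: neg_neg_neg flip: neg_def)

lemmas regular_simps = regular_algebra_lattice regular_algebra_carrier regular_algebra_le
  regular_algebra_imp regular_algebra_neg

text \<open>The Sasaki equation is (nS) negated once more. Modus ponens holds since, for regular
  \<open>a\<close> and \<open>b\<close>, (Nu) and (MP) give \<open>a \<sqinter> \<sim>\<sim>(a
  \<leadsto> b) = \<sim>\<sim>(a \<sqinter> b) = a \<sqinter> b\<close>.\<close>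

lemma regular_algebra_orthomodular: "orthomodular_algebra (regular_algebra L)"
proof -
  interpret K: bounded_lattice "regular_algebra L"
    by (rule regular_algebra_lattice)
  have "a \<sqinter> \<sim>\<sim>(a \<leadsto> b) \<sqsubseteq> b"
    if "a \<in> carrier L" "\<sim>\<sim>a = a" "b \<in> carrier L" "\<sim>\<sim>b = b" for a b
    using that neg_neg_meet[of a "a \<leadsto> b"] meet_right[of a b] by (simp add: MP neg_neg_meet)
  then show ?thesis
    by unfold_locales
      (simp_all add: regular_simps neg_neg_neg neg_neg_meet meet_neg neg_antitone nS)
qed

lemma neg_neg_hom: "imp_hom L (regular_algebra L) (\<lambda>a. \<sim>\<sim>a)"
  by unfold_locales
    (simp_all add: regular_simps neg_neg_neg neg_neg_meet neg_join_neg_neg neg_imp_neg_neg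
      neg_bottom neg_top)

end

subsection \<open>The Heyting algebra of up-sets of prime filters\<close>

text \<open>The complex algebra of the Kripke frame \<open>X\<close> ordered by inclusion;
  \<open>imp\<close> is the Kripke forcing clause for implication.\<close>

definition upset_algebra :: "'a set set \<Rightarrow> 'a set set imp_algebra" where
  "upset_algebra X = \<lparr>carrier = {U. U \<subseteq> X \<and> (\<forall>F \<in> U. \<forall>G \<in> X. F \<subseteq> G \<longrightarrow> G \<in> U)}, eq = (=),
    le = (\<subseteq>), imp = (\<lambda>U V. {F \<in> X. \<forall>G \<in> X. F \<subseteq> G \<longrightarrow> G \<in> U \<longrightarrow> G \<in> V})\<rparr>"

lemma upset_algebra_lattice:
  fixes X :: "'a set set"
  defines "K \<equiv> upset_algebra X"
  shows "bounded_lattice K"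
    and "\<bottom>\<^bsub>K\<^esub> = {}" and "\<top>\<^bsub>K\<^esub> = X"
    and "\<And>U V. \<lbrakk>U \<in> carrier K; V \<in> carrier K\<rbrakk> \<Longrightarrow> U \<sqinter>\<^bsub>K\<^esub> V = U \<inter> V"
    and "\<And>U V. \<lbrakk>U \<in> carrier K; V \<in> carrier K\<rbrakk> \<Longrightarrow> U \<squnion>\<^bsub>K\<^esub> V = U \<union> V"
  by (rule bounded_lattice_presentation[where L = K and z = "{}" and t = X
        and m = "(\<inter>)" and j = "(\<union>)"]; auto simp: K_def upset_algebra_def)+

lemma upset_algebra_heyting: "heyting_algebra (upset_algebra X)"
proof -
  let ?K = "upset_algebra X"
  interpret K: bounded_lattice ?K by (rule upset_algebra_lattice)
  have imp: "(U \<leadsto>\<^bsub>?K\<^esub> V) = {F \<in> X. \<forall>G \<in> X. F \<subseteq> G \<longrightarrow> G \<in> U \<longrightarrow> G \<in> V}" for U V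
    by (simp add: upset_algebra_def)
  have carrier: "U \<in> carrier ?K \<longleftrightarrow> U \<subseteq> X \<and> (\<forall>F \<in> U. \<forall>G \<in> X. F \<subseteq> G \<longrightarrow> G \<in> U)" for U
    by (simp add: upset_algebra_def)
  have le: "U \<sqsubseteq>\<^bsub>?K\<^esub> V \<longleftrightarrow> U \<subseteq> V" for U V
    by (simp add: upset_algebra_def)
  have imp_closed: "(U \<leadsto>\<^bsub>?K\<^esub> V) \<in> carrier ?K" for U V
    by (auto simp: imp carrier)
  \<comment> \<open>The forward direction uses that \<open>U\<close> is an up-set; the backward
    direction takes \<open>G = F\<close>.\<close>
  have res: "U \<inter> V \<subseteq> W \<longleftrightarrow> U \<subseteq> (V \<leadsto>\<^bsub>?K\<^esub> W)"
    if "U \<in> carrier ?K" for U V W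
  proof
    have U: "F \<in> X" "\<lbrakk>G \<in> X; F \<subseteq> G\<rbrakk> \<Longrightarrow> G \<in> U" if "F \<in> U" for F G
      using \<open>U \<in> carrier ?K\<close> that unfolding carrier by blast+
    show "U \<subseteq> (V \<leadsto>\<^bsub>?K\<^esub> W)" if "U \<inter> V \<subseteq> W"
      using U that unfolding imp by auto
    show "U \<inter> V \<subseteq> W" if "U \<subseteq> (V \<leadsto>\<^bsub>?K\<^esub> W)"
      using U(1) that unfolding imp by auto
  qed
  have neg: "\<sim>\<^bsub>?K\<^esub> U = {F \<in> X. \<forall>G \<in> X. F \<subseteq> G \<longrightarrow> G \<notin> U}" for U
    by (simp add: neg_def imp upset_algebra_lattice)
  have neg_closed: "\<sim>\<^bsub>?K\<^esub> U \<in> carrier ?K" for U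
    by (simp add: neg_def imp_closed)
  have le_neg_neg: "U \<subseteq> \<sim>\<^bsub>?K\<^esub> \<sim>\<^bsub>?K\<^esub> U" if "U \<in> carrier ?K" for U
    using that unfolding neg carrier by auto
  have meet_neg: "U \<inter> \<sim>\<^bsub>?K\<^esub> U = {}" for U
    unfolding neg by auto
  have antitone: "\<sim>\<^bsub>?K\<^esub> V \<subseteq> \<sim>\<^bsub>?K\<^esub> U" if "U \<subseteq> V" for U V
    using that unfolding neg by auto
  show ?thesis
    by unfold_locales
      (simp_all add: upset_algebra_lattice imp_closed neg_closed le res le_neg_neg meet_neg antitone)
qed

text \<open>The canonical map of the prime filter representation.\<close>

definition filters_containing :: "('a, 'b) gorder_scheme \<Rightarrow> 'a \<Rightarrow> 'a set set" where
  "filters_containing L a = {F. prime_filter L F \<and> a \<in> F}"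

context joint_algebra
begin

text \<open>Applying (iCl2) with \<open>a\<close> equal to the right-hand side, whose implication to itself is
  \<open>\<top>\<close> by (M), makes the quotient by a prime filter distributive.\<close>

lemma distrib_modulo_prime_filter:
  assumes F: "prime_filter L F" and [simp]: "b \<in> carrier L" "c \<in> carrier L" "d \<in> carrier L"
  shows "\<exists>f \<in> F. f \<sqinter> (b \<sqinter> (c \<squnion> d)) \<sqsubseteq> (b \<sqinter> c) \<squnion> (b \<sqinter> d)"
proof -
  note filter = prime_filterD(1)[OF F]
  let ?r = "(b \<sqinter> c) \<squnion> (b \<sqinter> d)" and ?l = "b \<sqinter> (c \<squnion> d)"
  have "(?r \<leadsto> ?r) = \<top>"
    using M[of ?r ?r] meet_absorb[of ?r ?r] by simp
  then have "?l \<squnion> (?l \<leadsto> ?r) = \<top>"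
    using iCl2[of ?r b c d] by (simp add: top_le_iff)
  \<comment> \<open>Primality gives two cases. In the first, \<open>?r\<close> itself belongs to
    \<open>F\<close> and is the witness; in the second, the implication is the witness through
    (MP).\<close>
  then consider "?l \<in> F" | "(?l \<leadsto> ?r) \<in> F"
    using prime_filterD(3)[OF F, of ?l "?l \<leadsto> ?r"] lattice_filterD(2)[OF filter] by auto
  then show ?thesis
  proof cases
    case 1
    then have "?r \<in> F"
      by (simp add: meet_in_filter_iff[OF filter] join_in_prime_filter_iff[OF F])
    then show ?thesis by (auto intro!: bexI[of _ ?r] meet_left)
  next
    case 2
    have "(?l \<leadsto> ?r) \<sqinter> ?l = ?l \<sqinter> ?r"
      using MP[of ?l ?r] by (simp add: meet_comm[of L _ ?l])
    then have "(?l \<leadsto> ?r) \<sqinter> ?l \<sqsubseteq> ?r" by (simp add: meet_right)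
    with 2 show ?thesis by blast
  qed
qed

text \<open>The truth lemma for implication in the canonical frame. (MP) gives the forward
  direction; conversely, either \<open>a\<close> is already in \<open>F\<close>, or \<open>b\<close>
  lies in the filter generated by \<open>F\<close> and \<open>a\<close>, and (iCl1) brings the
  implication back into \<open>F\<close>.\<close>

lemma imp_in_prime_filter_iff:
  assumes F: "prime_filter L F" and [simp]: "a \<in> carrier L" "b \<in> carrier L"
  shows "(a \<leadsto> b) \<in> F \<longleftrightarrow> (\<forall>G. prime_filter L G \<longrightarrow> F \<subseteq> G \<longrightarrow> a \<in> G \<longrightarrow> b \<in> G)"
proof (intro iffI allI impI)
  fix G
  assume ab: "(a \<leadsto> b) \<in> F" and G: "prime_filter L G" "F \<subseteq> G" "a \<in> G"
  then have "a \<sqinter> (a \<leadsto> b) \<in> G"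
    by (auto simp: meet_in_filter_iff[OF prime_filterD(1)[OF G(1)]])
  then show "b \<in> G"
    by (simp add: MP meet_in_filter_iff[OF prime_filterD(1)[OF G(1)]])
next
  note filter = prime_filterD(1)[OF F]
  note [simp] = lattice_filterD(1)[OF filter]
  assume ext: "\<forall>G. prime_filter L G \<longrightarrow> F \<subseteq> G \<longrightarrow> a \<in> G \<longrightarrow> b \<in> G"
  show "(a \<leadsto> b) \<in> F"
  proof (cases "a \<in> F")
    case True
    \<comment> \<open>The assumption at \<open>G = F\<close> gives \<open>b \<in> F\<close>, and
      (MP) is then read from right to left.\<close>
    then have "a \<sqinter> (a \<leadsto> b) \<in> F"
      using ext F by (simp add: MP meet_in_filter_iff[OF filter])
    then show ?thesis by (simp add: meet_in_filter_iff[OF filter])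
  next
    case False
    note adj = adjoin_filter[OF filter, of a]
    have "b \<in> adjoin L F a"
    proof (rule ccontr)
      assume "b \<notin> adjoin L F a"
      \<comment> \<open>Distributivity modulo \<open>F\<close> persists in the larger filter,
        although that filter need not be prime.\<close>
      moreover have "\<exists>f \<in> adjoin L F a.
          f \<sqinter> (g \<sqinter> (c \<squnion> d)) \<sqsubseteq> ((g \<sqinter> c) \<squnion> (g \<sqinter> d)) \<squnion> b"
        if "g \<in> carrier L" "c \<in> carrier L" "d \<in> carrier L" for g c d
        using distrib_modulo_prime_filter[OF F that] adj(2) that
        by (force intro: le_join_left)
      ultimately obtain G where "prime_filter L G" "adjoin L F a \<subseteq> G" "b \<notin> G"
        using prime_filter_extension[OF adj(1)] by (metis assms(2,3))
      then show False using ext adj by auto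
    qed
    then obtain f where f: "f \<in> F" "f \<sqinter> a \<sqsubseteq> b"
      by (auto simp: adjoin_def)
    \<comment> \<open>(M) trivializes the implication in (iCl1), which then puts
      \<open>a \<squnion> (a \<leadsto> b)\<close> above \<open>f\<close>; primality and
      \<open>a \<notin> F\<close> leave only the implication.\<close>
    have "((f \<sqinter> a) \<leadsto> b) = \<top>"
      using M[of "f \<sqinter> a" b] f by (simp add: meet_absorb)
    then have "f \<sqsubseteq> a \<squnion> (a \<leadsto> b)"
      using iCl1[of f a b] f meet_absorb[of f \<top>] by (simp add: top_higher)
    then have "a \<squnion> (a \<leadsto> b) \<in> F"
      using lattice_filterD(3)[OF filter f(1)] by simp
    then show ?thesis
      using False by (simp add: join_in_prime_filter_iff[OF F])
  qed
qed

lemma filters_containing_hom: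
  "imp_hom L (upset_algebra {F. prime_filter L F}) (filters_containing L)"
proof -
  let ?K = "upset_algebra {F. prime_filter L F}"
  have closed: "filters_containing L a \<in> carrier ?K" for a
    by (auto simp: filters_containing_def upset_algebra_def)
  have imp: "(U \<leadsto>\<^bsub>?K\<^esub> V) = {F. prime_filter L F
      \<and> (\<forall>G. prime_filter L G \<longrightarrow> F \<subseteq> G \<longrightarrow> G \<in> U \<longrightarrow> G \<in> V)}" for U V
    by (auto simp: upset_algebra_def)
  show ?thesis
  proof unfold_locales
    show "filters_containing L \<bottom> = \<bottom>\<^bsub>?K\<^esub>"
      using prime_filterD(2)[of L] by (simp add: upset_algebra_lattice filters_containing_def)
    show "filters_containing L \<top> = \<top>\<^bsub>?K\<^esub>"
      using lattice_filterD(2)[OF prime_filterD(1)]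
      by (auto simp: upset_algebra_lattice filters_containing_def)
  next
    fix a b
    assume [simp]: "a \<in> carrier L" "b \<in> carrier L"
    show "(a \<leadsto> b) \<in> carrier L" by simp
    show "filters_containing L (a \<sqinter> b) = filters_containing L a \<sqinter>\<^bsub>?K\<^esub> filters_containing L b"
      by (simp add: closed upset_algebra_lattice)
        (auto simp: filters_containing_def meet_in_filter_iff prime_filterD(1))
    show "filters_containing L (a \<squnion> b) = filters_containing L a \<squnion>\<^bsub>?K\<^esub> filters_containing L b"
      by (simp add: closed upset_algebra_lattice)
        (auto simp: filters_containing_def join_in_prime_filter_iff)
    show "filters_containing L (a \<leadsto> b) = (filters_containing L a \<leadsto>\<^bsub>?K\<^esub> filters_containing L b)"
      unfolding imp filters_containing_def
      by (intro Collect_cong conj_cong refl) (auto simp: imp_in_prime_filter_iff)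
  qed
qed

text \<open>Below \<open>a\<close> the conjunct \<open>\<sim>\<sim>b\<close> comes for free, so (Vi)
  with \<open>d = b\<close> is the distributivity that \<open>prime_filter_extension\<close> asks
  for, with \<open>a\<close> as the witness in its principal filter.\<close>

lemma prime_filter_separation:
  assumes [simp]: "a \<in> carrier L" "b \<in> carrier L" and "a \<sqsubseteq> \<sim>\<sim>b" "\<not> a \<sqsubseteq> b"
  obtains F where "prime_filter L F" "a \<in> F" "b \<notin> F"
proof -
  let ?F = "{x \<in> carrier L. a \<sqsubseteq> x}"
  have "a \<sqinter> (g \<sqinter> (c \<squnion> d)) \<sqsubseteq> ((g \<sqinter> c) \<squnion> (g \<sqinter> d)) \<squnion> b"
    if [simp]: "g \<in> carrier L" "c \<in> carrier L" "d \<in> carrier L" for g c d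
  proof -
    have "a \<sqinter> (g \<sqinter> (c \<squnion> d)) \<sqsubseteq> g \<sqinter> (c \<squnion> d) \<sqinter> \<sim>\<sim>b"
      using assms by (simp add: le_meet_iff meet_le_left meet_le_right meet_left meet_right)
    then show ?thesis
      using Vi[of g c d b] le_trans by (meson join_closed meet_closed neg_closed that assms(1,2))
  qed
  then obtain G where "prime_filter L G" "?F \<subseteq> G" "b \<notin> G"
    using prime_filter_extension[OF principal_filter[of a], of b] assms
    by (metis (mono_tags, lifting) le_refl mem_Collect_eq)
  moreover from this have "a \<in> G" by auto
  ultimately show thesis by (intro that)
qed

end

section \<open>Transfer between the carrier types, and the two quotients combined\<close>

theorem theorem4p3:
  fixes \<phi> \<psi> :: "'v form"
  assumes "infinite (UNIV :: 'h set)"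
    and "infinite (UNIV :: 'o set)"
    and "infinite (UNIV :: 'f set)"
  shows "((\<forall>H :: 'h imp_algebra. heyting_algebra H \<longrightarrow> valid_in H \<phi> \<psi>) \<and>
          (\<forall>K :: 'o imp_algebra. orthomodular_algebra K \<longrightarrow> valid_in K \<phi> \<psi>))
         \<longleftrightarrow> (\<forall>L :: 'f imp_algebra. joint_algebra L \<longrightarrow> valid_in L \<phi> \<psi>)"
proof (intro iffI conjI allI impI)
  fix H :: "'h imp_algebra"
  assume joint: "\<forall>L :: 'f imp_algebra. joint_algebra L \<longrightarrow> valid_in L \<phi> \<psi>"
    and "heyting_algebra H"
  then interpret H: heyting_algebra H by simp
  \<comment> \<open>\<open>H\<close> is itself a joint algebra, and so are its embedded copies over
    \<open>'f\<close>; validity in those copies suffices.\<close>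
  show "valid_in H \<phi> \<psi>"
    using H.fundamental_algebra_axioms assms(3)
    by (rule valid_in_transfer) (use joint imp_embedding.joint[OF _ H.joint] in blast)
next
  fix K :: "'o imp_algebra"
  assume joint: "\<forall>L :: 'f imp_algebra. joint_algebra L \<longrightarrow> valid_in L \<phi> \<psi>"
    and "orthomodular_algebra K"
  then interpret K: orthomodular_algebra K by simp
  show "valid_in K \<phi> \<psi>"
    using K.fundamental_algebra_axioms assms(3)
    by (rule valid_in_transfer) (use joint imp_embedding.joint[OF _ K.joint] in blast)
next
  fix L :: "'f imp_algebra"
  assume valid: "(\<forall>H :: 'h imp_algebra. heyting_algebra H \<longrightarrow> valid_in H \<phi> \<psi>) \<and>
      (\<forall>K :: 'o imp_algebra. orthomodular_algebra K \<longrightarrow> valid_in K \<phi> \<psi>)"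
    and "joint_algebra L"
  then interpret L: joint_algebra L by simp
  let ?R = "regular_algebra L" and ?U = "upset_algebra {F. prime_filter L F}"
  interpret R: orthomodular_algebra ?R by (rule L.regular_algebra_orthomodular)
  interpret U: heyting_algebra ?U by (rule upset_algebra_heyting)
  interpret r: imp_hom L ?R "\<lambda>a. \<sim>\<^bsub>L\<^esub>\<sim>\<^bsub>L\<^esub>a" by (rule L.neg_neg_hom)
  interpret u: imp_hom L ?U "filters_containing L" by (rule L.filters_containing_hom)
  \<comment> \<open>The quotients have carriers in \<open>'f\<close> and \<open>'f set set\<close>;
    their embedded copies over \<open>'o\<close> and \<open>'h\<close> are the ones to which
    \<open>valid\<close> applies.\<close>
  have validR: "valid_in ?R \<phi> \<psi>"
    using R.fundamental_algebra_axioms assms(2)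
    by (rule valid_in_transfer) (use valid imp_embedding.orthomodular[OF _ R.orthomodular_algebra_axioms] in blast)
  have validU: "valid_in ?U \<phi> \<psi>"
    using U.fundamental_algebra_axioms assms(1)
    by (rule valid_in_transfer) (use valid imp_embedding.heyting[OF _ U.heyting_algebra_axioms] in blast)
  show "valid_in L \<phi> \<psi>"
    unfolding valid_in_def
  proof (intro allI impI)
    fix v :: "'v \<Rightarrow> 'f"
    assume "\<forall>p. v p \<in> carrier L"
    then have v: "v p \<in> carrier L" for p by blast
    let ?a = "eval L v \<phi>" and ?b = "eval L v \<psi>"
    have ab: "?a \<in> carrier L" "?b \<in> carrier L"
      by (rule r.eval_in_carrier, rule v)+
    let ?r = "(\<lambda>a. \<sim>\<^bsub>L\<^esub>\<sim>\<^bsub>L\<^esub>a) \<circ> v"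
    have "\<forall>p. ?r p \<in> carrier ?R"
      by (simp add: v L.regular_algebra_carrier L.neg_neg_neg)
    then have "eval ?R ?r \<phi> \<sqsubseteq>\<^bsub>?R\<^esub> eval ?R ?r \<psi>"
      using validR unfolding valid_in_def by blast
    then have "\<sim>\<^bsub>L\<^esub>\<sim>\<^bsub>L\<^esub>?a \<sqsubseteq>\<^bsub>L\<^esub> \<sim>\<^bsub>L\<^esub>\<sim>\<^bsub>L\<^esub>?b"
      by (simp only: r.eval_hom[of v, OF v] L.regular_algebra_le)
    \<comment> \<open>The orthomodular quotient loses only double negations: this bound is the
      hypothesis under which prime filters separate.\<close>
    then have le: "?a \<sqsubseteq>\<^bsub>L\<^esub> \<sim>\<^bsub>L\<^esub>\<sim>\<^bsub>L\<^esub>?b"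
      using ab L.le_trans[OF L.le_neg_neg[OF ab(1)]] by simp
    let ?u = "filters_containing L \<circ> v"
    have "\<forall>p. ?u p \<in> carrier ?U"
      by (auto simp: filters_containing_def upset_algebra_def)
    then have "eval ?U ?u \<phi> \<sqsubseteq>\<^bsub>?U\<^esub> eval ?U ?u \<psi>"
      using validU unfolding valid_in_def by blast
    then have sub: "filters_containing L ?a \<subseteq> filters_containing L ?b"
      by (simp add: u.eval_hom[of v, OF v] upset_algebra_def)
    show "?a \<sqsubseteq>\<^bsub>L\<^esub> ?b"
    proof (rule ccontr)
      assume "\<not> ?a \<sqsubseteq>\<^bsub>L\<^esub> ?b"
      then obtain F where "prime_filter L F" "?a \<in> F" "?b \<notin> F"
        by (rule L.prime_filter_separation[OF ab le])
      then show False using sub by (auto simp: filters_containing_def)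
    qed
  qed
qed

end
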